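(* Let $k\in\mathbb{Z}$ and let $n \geq m \geq 1$ be integers. Then \begin{equation*} \begin{split} &\sum_{l=0}^{n-m}m!\binom{n}{l+m}S_{1}(l+m,m)C_{n-l-m}^{(k)}\\ &=\sum_{l=0}^{n-m}(m-1)!\binom{n-1}{l+m-1}S_{1}(l+m-1,m-1)\left\{(m-1)C_{n-l-m}^{(k)}(1)+C_{n-l-m}^{(k-1)}(1)\right\}. \end{split} \end{equation*}
   Context: For $k\in\mathbb{Z}$, $Lif_k(t)=\sum_{m=0}^{\infty}\frac{t^m}{m!(m+1)^k}$, and the poly-Cauchy polynomials $C_n^{(k)}(x)$ are defined by $\frac{Lif_k(\log(1+t))}{(1+t)^x}=\sum_{n=0}^\infty C_n^{(k)}(x)\frac{t^n}{n!}$; $C_n^{(k)}=C_n^{(k)}(0)$. The Stirling numbers of the first kind $S_1(l,m)$ are defined by $(\log(1+t))^m=m!\sum_{l\ge m}S_1(l,m)\frac{t^l}{l!}$ (so $S_1(0,0)=1$ and $S_1(l,0)=0$ for $l\ge1$). *)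

theory Defs
  imports "HOL-Computational_Algebra.Computational_Algebra"
begin

text \<open>
  All generating functions are formal power series in \<open>t\<close> over a field of characteristic zero.
  The library series \<^term>\<open>fps_ln 1\<close> is \<open>log(1+t)\<close> and \<^term>\<open>fps_binomial x\<close> is \<open>(1+t)\<^sup>x\<close>.
\<close>

definition Lif :: "int \<Rightarrow> 'a::field_char_0 fps" where
  "Lif k = Abs_fps (\<lambda>m. 1 / (fact m * of_nat (m + 1) powi k))"

text \<open>\<open>poly_cauchy k n x\<close> is the value at \<open>x\<close> of the polynomial \<open>C\<^sub>n\<^bsup>(k)\<^esup>\<close>.\<close>

definition poly_cauchy :: "int \<Rightarrow> nat \<Rightarrow> 'a::field_char_0 \<Rightarrow> 'a" where
  "poly_cauchy k n x = fact n * fps_nth (fps_compose (Lif k) (fps_ln 1) / fps_binomial x) n"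

text \<open>
  The signed Stirling numbers of the first kind; the library function \<open>stirling\<close>
  from \<open>HOL-Combinatorics\<close> is the unsigned version.
\<close>

definition S1 :: "nat \<Rightarrow> nat \<Rightarrow> 'a::field_char_0" where
  "S1 l m = fact l / fact m * fps_nth (fps_ln 1 ^ m) l"

lemma poly_cauchy_egf:
  "fps_compose (Lif k) (fps_ln 1) / fps_binomial x = Abs_fps (\<lambda>n. poly_cauchy k n x / fact n)"
  by (simp add: fps_eq_iff poly_cauchy_def)

lemma S1_egf:
  "fps_ln 1 ^ m = fps_const (fact m) * Abs_fps (\<lambda>l. if l \<ge> m then S1 l m / fact l else 0)"
  by (auto simp: fps_eq_iff S1_def startsby_zero_power_prefix)

lemma S1_0_right: "S1 l 0 = (if l = 0 then 1 else 0)"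
  by (simp add: S1_def)

end

theory Submission
  imports Defs
begin

text \<open>
  Both sides are coefficients of exponential generating functions, and the identity says that
  \<open>(log(1+t))\<^sup>m Lif\<^sub>k(log(1+t))\<close> may be differentiated term by term or by the chain rule. Since
  \<open>(u Lif\<^sub>k(u))' = Lif\<^bsub>k-1\<^esub>(u)\<close>, one has
  \<open>(u\<^sup>m Lif\<^sub>k(u))' = u\<^bsup>m-1\<^esup> ((m-1) Lif\<^sub>k(u) + Lif\<^bsub>k-1\<^esub>(u))\<close>; substituting \<open>u = log(1+t)\<close>
  contributes the factor \<open>1/(1+t)\<close>, which shifts the argument of the polynomials from 0 to 1.
\<close>

text \<open>Shifting by \<open>fps_X\<close> and differentiating multiplies coefficient
  \<open>n\<close> by \<open>n + 1\<close>, which cancels one factor of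
  \<open>(n + 1) powi k\<close>.\<close>

lemma fps_deriv_X_Lif:
  "fps_deriv (fps_X * Lif k) = (Lif (k - 1) :: 'a::field_char_0 fps)"
proof (rule fps_ext)
  fix n
  have "(of_nat (Suc n) :: 'a) \<noteq> 0" by (rule of_nat_neq_0)
  then show "fps_deriv (fps_X * Lif k) $ n = (Lif (k - 1) :: 'a fps) $ n"
    by (simp add: Lif_def power_int_diff fps_deriv_nth del: of_nat_Suc fps_deriv_mult)
qed

lemma fps_deriv_X_power_Lif:
  "fps_deriv (fps_X ^ Suc p * Lif k) =
     fps_X ^ p * (of_nat p * Lif k + (Lif (k - 1) :: 'a::field_char_0 fps))"
proof -
  have "fps_deriv (fps_X ^ Suc p * Lif k) = fps_deriv (fps_X ^ p * (fps_X * Lif k :: 'a fps))"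
    by (simp add: mult_ac)
  also have "\<dots> = fps_X ^ p * Lif (k - 1) + fps_deriv (fps_X ^ p) * (fps_X * Lif k)"
    by (simp only: fps_deriv_mult[of "fps_X ^ p"] fps_deriv_X_Lif)
  \<comment> \<open>The extra factor \<open>fps_X\<close> avoids the exponent \<open>p - 1\<close>,
    so \<open>p = 0\<close> is no special case.\<close>
  also have "fps_deriv (fps_X ^ p) * fps_X = (of_nat p * fps_X ^ p :: 'a fps)"
    by (induction p) (simp_all add: algebra_simps)
  then have "fps_deriv (fps_X ^ p) * (fps_X * Lif k) = of_nat p * fps_X ^ p * (Lif k :: 'a fps)"
    by (metis mult.assoc)
  finally show ?thesis by (simp add: algebra_simps)
qed

lemma fps_deriv_ln_power_Lif_ln:
  fixes k :: int
  defines "L \<equiv> fps_ln (1 :: 'a::field_char_0)"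
  shows "fps_deriv (L ^ Suc p * (Lif k oo L)) =
     L ^ p * (of_nat p * ((Lif k oo L) / fps_binomial 1) + (Lif (k - 1) oo L) / fps_binomial 1)"
proof -
  have L0: "L $ 0 = 0" by (simp add: L_def)
  have compose: "(fps_X ^ q * A) oo L = L ^ q * (A oo L)" for q and A :: "'a fps"
    using L0 by (simp add: fps_compose_mult_distrib fps_X_power_compose)
  have of_nat: "of_nat p oo L = (of_nat p :: 'a fps)"
    by (simp add: fps_of_nat[symmetric] del: fps_of_nat)
  have "fps_deriv (L ^ Suc p * (Lif k oo L)) = fps_deriv ((fps_X ^ Suc p * Lif k) oo L)"
    by (simp only: compose)
  also have "\<dots> = (fps_deriv (fps_X ^ Suc p * Lif k) oo L) * fps_deriv L"
    using L0 by (rule fps_compose_deriv)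
  also have "\<dots> = L ^ p * (of_nat p * (Lif k oo L) + (Lif (k - 1) oo L)) * inverse (1 + fps_X)"
    using L0 by (simp only: fps_deriv_X_power_Lif compose fps_compose_add_distrib
        fps_compose_mult_distrib of_nat) (simp add: L_def fps_ln_deriv)
  finally show ?thesis
    by (simp add: fps_binomial_1 fps_divide_unit algebra_simps)
qed

text \<open>The factorials in \<open>S1\<close> and the binomial coefficient combine to
  \<open>fact n\<close>, leaving a Cauchy product. Keeping \<open>A\<close> arbitrary lets this
  serve both sides of the identity.\<close>

lemma S1_binomial_convolution:
  fixes A :: "'a::field_char_0 fps"
  assumes "m \<le> n"
  shows "(\<Sum>l = 0..n - m. fact m * of_nat (n choose (l + m)) * S1 (l + m) m
             * (fact (n - l - m) * A $ (n - l - m)))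
       = fact n * (fps_ln 1 ^ m * A) $ n"
proof -
  let ?f = "\<lambda>j. (fps_ln 1 ^ m :: 'a fps) $ j * A $ (n - j)"
  have "fact m * of_nat (n choose (l + m)) * S1 (l + m) m
          * (fact (n - l - m) * A $ (n - l - m)) = fact n * ?f (l + m)"
    if "l \<in> {0..n - m}" for l
  proof -
    have "l + m \<le> n" using that assms by auto
    then show ?thesis
      by (simp add: S1_def binomial_fact add.commute field_simps)
  qed
  then have "(\<Sum>l = 0..n - m. fact m * of_nat (n choose (l + m)) * S1 (l + m) m
             * (fact (n - l - m) * A $ (n - l - m))) = fact n * (\<Sum>l = 0..n - m. ?f (l + m))"
    unfolding sum_distrib_left by (rule sum.cong[OF refl])
  also have "(\<Sum>l = 0..n - m. ?f (l + m)) = (\<Sum>j = m..n. ?f j)"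
    using sum.shift_bounds_cl_nat_ivl[of ?f 0 m "n - m"] assms by simp
  \<comment> \<open>The series \<open>fps_ln 1 ^ m\<close> has no terms of degree below
    \<open>m\<close>.\<close>
  also have "\<dots> = (\<Sum>j = 0..n. ?f j)"
    by (rule sum.mono_neutral_left) (auto simp: startsby_zero_power_prefix)
  finally show ?thesis by (simp add: fps_mult_nth)
qed

theorem theorem5:
  fixes k :: int and n m :: nat
  assumes "1 \<le> m" and "m \<le> n"
  shows "(\<Sum>l = 0..n - m. fact m * of_nat (n choose (l + m)) * S1 (l + m) m
             * poly_cauchy k (n - l - m) (0 :: 'a::field_char_0))
       = (\<Sum>l = 0..n - m. fact (m - 1) * of_nat ((n - 1) choose (l + m - 1)) * S1 (l + m - 1) (m - 1)
             * (of_nat (m - 1) * poly_cauchy k (n - l - m) 1 + poly_cauchy (k - 1) (n - l - m) 1))"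
proof -
  obtain p where m: "m = Suc p" using assms by (cases m) auto
  obtain q where n: "n = Suc q" using assms by (cases n) auto
  have "p \<le> q" using assms m n by simp
  let ?F = "\<lambda>k. Lif k oo fps_ln 1 :: 'a fps"
  \<comment> \<open>The exponential generating function of the bracket on the right-hand
    side.\<close>
  let ?A = "of_nat p * (?F k / fps_binomial 1) + ?F (k - 1) / fps_binomial 1"
  have A: "of_nat p * poly_cauchy k i 1 + poly_cauchy (k - 1) i 1 = fact i * ?A $ i" for i
    by (simp add: poly_cauchy_def fps_mult_of_nat_nth algebra_simps)
  \<comment> \<open>At argument 0 the divisor \<open>fps_binomial 0\<close> is 1.\<close>
  have "(\<Sum>l = 0..n - m. fact m * of_nat (n choose (l + m)) * S1 (l + m) m
             * poly_cauchy k (n - l - m) (0 :: 'a)) = fact n * (fps_ln 1 ^ m * ?F k) $ n"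
    using S1_binomial_convolution[OF assms(2), of "?F k"] by (simp add: poly_cauchy_def)
  \<comment> \<open>Differentiation shifts an exponential generating function by one index, and
    \<open>n = Suc q\<close>.\<close>
  also have "\<dots> = fact q * fps_deriv (fps_ln 1 ^ Suc p * ?F k) $ q"
    by (simp add: m n mult_ac del: fps_deriv_mult power_Suc of_nat_Suc)
  also have "\<dots> = fact q * (fps_ln 1 ^ p * ?A) $ q"
    by (simp only: fps_deriv_ln_power_Lif_ln)
  also have "\<dots> = (\<Sum>l = 0..q - p. fact p * of_nat (q choose (l + p)) * S1 (l + p) p
             * (fact (q - l - p) * ?A $ (q - l - p)))"
    using S1_binomial_convolution[OF \<open>p \<le> q\<close>, of ?A] by simp
  finally show ?thesis
    by (simp add: m n A[symmetric] del: fps_add_nth)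
qed

end
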